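(* Let $\{F_\varsigma\}_{\varsigma\in\mathfrak{A}}$ be a continuous frame for $\mathcal{H}^N$ with frame operator $S_F$. If $\alpha\in\mathbb{C}$, $V$ is an invertible operator on $\mathcal{H}^N$, and $\{F_\varsigma\}_{\varsigma\in\mathfrak{A}}$ is an $\alpha$-tight $V$-controlled integral frame, then $V=\alpha S_F^{-1}$; that is, $\{F_\varsigma\}_{\varsigma\in\mathfrak{A}}$ is exactly an $\alpha$-tight $\alpha S_F^{-1}$-controlled integral frame.
   Context: $(\mathfrak{A},\mu)$ is a measure space with positive measure $\mu$, and $\mathcal{H}^N$ is an $N$-dimensional complex Hilbert space, with inner product linear in the first variable. Families are assumed weakly measurable: $\varsigma\mapsto\langle f,F_\varsigma\rangle$ is measurable for each $f$. A family $\{F_\varsigma\}_{\varsigma\in\mathfrak{A}}\subset\mathcal{H}^N$ is a continuous (integral) frame if there are $0<A\le B<\infty$ with $A\|f\|^2\le\int_{\mathfrak{A}}|\langle f,F_\varsigma\rangle|^2d\mu(\varsigma)\le B\|f\|^2$ for all $f$; its frame operator $S_Ff=\int_{\mathfrak{A}}\langle f,F_\varsigma\rangle F_\varsigma\,d\mu(\varsigma)$ (weak sense) is positive and invertible. For an invertible operator $V$ on $\mathcal{H}^N$ and $\alpha\in\mathbb{C}$, the family is an $\alpha$-tight $V$-controlled integral frame if $\int_{\mathfrak{A}}\langle f,F_\varsigma\rangle\langle VF_\varsigma,f\rangle\,d\mu(\varsigma)=\alpha\|f\|^2$ for all $f\in\mathcal{H}^N$. *)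

theory Defs
  imports "HOL-Analysis.Analysis"
begin

text \<open>
  The space is all of the type \<open>'h\<close>. Completeness of a Hilbert space is not listed as an axiom, since
  it is automatic for an inner product space of finite dimension. The inner product is linear in
  its first argument.
\<close>

locale complex_inner_space = vector_space cscale
  for cscale :: "complex \<Rightarrow> 'h \<Rightarrow> 'h::ab_group_add" +
  fixes ip :: "'h \<Rightarrow> 'h \<Rightarrow> complex"
  assumes ip_add_left: "ip (x + y) z = ip x z + ip y z"
    and ip_scale_left: "ip (cscale c x) z = c * ip x z"
    and ip_commute: "ip y x = cnj (ip x y)"
    and ip_pos_def: "x \<noteq> 0 \<Longrightarrow> 0 < Re (ip x x)"

locale complex_hilbert_space_of_dim = complex_inner_space cscale ip
  for cscale :: "complex \<Rightarrow> 'h \<Rightarrow> 'h::ab_group_add"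
    and ip :: "'h \<Rightarrow> 'h \<Rightarrow> complex" +
  fixes N :: nat
  assumes ex_basis: "\<exists>E. finite E \<and> card E = N \<and> independent E \<and> span E = UNIV"

definition ip_norm :: "('h \<Rightarrow> 'h \<Rightarrow> complex) \<Rightarrow> 'h \<Rightarrow> real" where
  "ip_norm ip f = sqrt (Re (ip f f))"

definition invertible_operator ::
    "(complex \<Rightarrow> 'h \<Rightarrow> 'h::ab_group_add) \<Rightarrow> ('h \<Rightarrow> 'h) \<Rightarrow> bool" where
  "invertible_operator cscale V \<longleftrightarrow> Vector_Spaces.linear cscale cscale V \<and> bij V"

definition weakly_measurable ::
    "('h \<Rightarrow> 'h \<Rightarrow> complex) \<Rightarrow> 's measure \<Rightarrow> ('s \<Rightarrow> 'h) \<Rightarrow> bool" where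
  "weakly_measurable ip M F \<longleftrightarrow> (\<forall>f. (\<lambda>s. ip f (F s)) \<in> borel_measurable M)"

definition continuous_frame ::
    "('h \<Rightarrow> 'h \<Rightarrow> complex) \<Rightarrow> 's measure \<Rightarrow> ('s \<Rightarrow> 'h) \<Rightarrow> bool" where
  "continuous_frame ip M F \<longleftrightarrow> weakly_measurable ip M F \<and>
     (\<exists>A B::real. 0 < A \<and> A \<le> B \<and>
       (\<forall>f. ennreal (A * (ip_norm ip f)\<^sup>2) \<le> (\<integral>\<^sup>+s. ennreal ((cmod (ip f (F s)))\<^sup>2) \<partial>M) \<and>
            (\<integral>\<^sup>+s. ennreal ((cmod (ip f (F s)))\<^sup>2) \<partial>M) \<le> ennreal (B * (ip_norm ip f)\<^sup>2)))"

text \<open>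
  The vector-valued integral \<open>\<integral> \<langle>f, F s\<rangle> F s d\<mu>(s)\<close> in the weak sense: the unique vector \<open>h\<close> with
  \<open>\<langle>h, g\<rangle> = \<integral> \<langle>f, F s\<rangle> \<langle>F s, g\<rangle> d\<mu>(s)\<close> for all \<open>g\<close>. It exists whenever \<open>F\<close> is a continuous frame.
\<close>

definition frame_operator ::
    "('h \<Rightarrow> 'h \<Rightarrow> complex) \<Rightarrow> 's measure \<Rightarrow> ('s \<Rightarrow> 'h) \<Rightarrow> 'h \<Rightarrow> 'h" where
  "frame_operator ip M F f =
     (THE h. \<forall>g. has_bochner_integral M (\<lambda>s. ip f (F s) * ip (F s) g) (ip h g))"

definition tight_controlled_frame ::
    "(complex \<Rightarrow> 'h \<Rightarrow> 'h::ab_group_add) \<Rightarrow> ('h \<Rightarrow> 'h \<Rightarrow> complex) \<Rightarrow> 's measure \<Rightarrow> ('s \<Rightarrow> 'h)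
      \<Rightarrow> complex \<Rightarrow> ('h \<Rightarrow> 'h) \<Rightarrow> bool" where
  "tight_controlled_frame cscale ip M F \<alpha> V \<longleftrightarrow>
     weakly_measurable ip M F \<and> invertible_operator cscale V \<and>
     (\<forall>f. has_bochner_integral M (\<lambda>s. ip f (F s) * ip (V (F s)) f)
            (\<alpha> * complex_of_real ((ip_norm ip f)\<^sup>2)))"

end

theory Submission
  imports Defs
begin

text \<open>
  Write \<open>S\<close> for the frame operator. Moving \<open>V\<close> to the other side of the inner product, the
  control integral at \<open>f\<close> is \<open>\<integral> \<langle>f, F s\<rangle> \<langle>F s, V* f\<rangle> d\<mu>(s) = \<langle>S f, V* f\<rangle> = \<langle>V (S f), f\<rangle>\<close>. Tightness thus
  says that the operator \<open>V \<circ> S - \<alpha>\<close> has vanishing quadratic form, and over the complex numbers such an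
  operator is zero by polarization (\<open>zero_quadratic_form_imp_zero\<close>). Hence \<open>V \<circ> S = \<alpha>\<close>, and \<open>S\<close> can
  be cancelled because it is bijective.

  Both the adjoint \<open>V*\<close> and the weakly defined operator \<open>S\<close> exist by the Riesz representation theorem
  in finite dimension (\<open>riesz_representation\<close>). The upper frame bound makes the integrand in the
  definition of \<open>S\<close> integrable; the lower one makes \<open>S\<close> injective, so that \<open>S\<close> is bijective by a
  count of dimensions.
\<close>

context complex_inner_space
begin

lemma ip_add_right: "ip x (y + z) = ip x y + ip x z"
  by (metis ip_add_left ip_commute complex_cnj_add)

lemma ip_scale_right: "ip x (cscale c y) = cnj c * ip x y"
  by (metis ip_scale_left ip_commute complex_cnj_mult)

lemma ip_zero_left: "ip 0 z = 0"
  using ip_add_left[of 0 0 z] by simp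

lemma ip_diff_left: "ip (x - y) z = ip x z - ip y z"
  using ip_add_left[of "x - y" y z] by simp

lemma ip_self_eq_zero: "ip x x = 0 \<Longrightarrow> x = 0"
  using ip_pos_def[of x] by fastforce

lemma ip_ext: "(\<And>g. ip x g = ip y g) \<Longrightarrow> x = y"
  using ip_self_eq_zero[of "x - y"] by (simp add: ip_diff_left)

lemma ip_self_nonneg: "0 \<le> Re (ip x x)"
  using ip_pos_def[of x] by (cases "x = 0") (auto simp: ip_zero_left)

lemma ip_norm_square: "complex_of_real ((ip_norm ip x)\<^sup>2) = ip x x"
proof -
  have "Im (ip x x) = 0"
    using arg_cong[OF ip_commute[of x x], of Im] by simp
  then show ?thesis
    by (simp add: ip_norm_def ip_self_nonneg complex_eq_iff)
qed

text \<open>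
  Polarization: replacing \<open>y\<close> by \<open>\<i> y\<close> in \<open>\<langle>T x, y\<rangle> + \<langle>T y, x\<rangle> = 0\<close> flips the relative sign of the two
  terms, so both vanish. Over the reals, rotation of the plane by a right angle is a
  counterexample.
\<close>

lemma zero_quadratic_form_imp_zero:
  assumes T: "Vector_Spaces.linear cscale cscale T"
    and zero: "\<And>x. ip (T x) x = 0"
  shows "T x = 0"
proof -
  have add: "T (y + z) = T y + T z" and scale: "T (cscale c y) = cscale c (T y)" for y z c
    using T by (simp_all add: Vector_Spaces.linear_iff)
  have sym: "ip (T y) z + ip (T z) y = 0" for y z
    using zero[of "y + z"] by (simp add: add ip_add_left ip_add_right zero add.commute)
  have "ip (T x) y = 0" for y
  proof -
    have "\<i> * (ip (T y) x - ip (T x) y) = 0"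
      using sym[of x "cscale \<i> y"] by (simp add: scale ip_scale_left ip_scale_right algebra_simps)
    with sym[of x y] show ?thesis
      by simp
  qed
  then show ?thesis
    by (intro ip_ext) (simp add: ip_zero_left)
qed

text \<open>
  Riesz representation on the span of a finite set, by induction on the set. Representing
  \<open>\<langle>-, e\<rangle>\<close> on the smaller span yields the orthogonal projection \<open>p\<close> of the new vector \<open>e\<close>; it
  remains to correct the old representing vector by a multiple of \<open>u = e - p\<close>.
\<close>

lemma riesz_representation_span:
  assumes "finite E"
    and "\<And>x y. \<phi> (x + y) = \<phi> x + \<phi> y"
    and "\<And>c x. \<phi> (cscale c x) = c * \<phi> x"
  shows "\<exists>g \<in> span E. \<forall>h \<in> span E. \<phi> h = ip h g"
  using assms
proof (induction E arbitrary: \<phi> rule: finite_induct)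
  case empty
  have "\<phi> 0 = 0"
    using empty(1)[of 0 0] by simp
  then show ?case
    by (simp add: ip_zero_left)
next
  case (insert e E)
  obtain g where g: "g \<in> span E" "\<And>h. h \<in> span E \<Longrightarrow> \<phi> h = ip h g"
    using insert.IH[of \<phi>] insert.prems by blast
  obtain p where p: "p \<in> span E" "\<And>h. h \<in> span E \<Longrightarrow> ip h e = ip h p"
    using insert.IH[of "\<lambda>h. ip h e"] ip_add_left ip_scale_left by blast
  define u where "u = e - p"
  have e: "e = u + p"
    by (simp add: u_def)
  have orth: "ip h u = 0" if "h \<in> span E" for h
    using p(2)[OF that] ip_add_right[of h u p] by (simp add: e)
  have orth': "ip u h = 0" if "h \<in> span E" for h
    using orth[OF that] ip_commute[of u h] by simp
  have u_span: "u \<in> span (insert e E)"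
    unfolding u_def by (meson p(1) span_base span_diff span_mono subset_insertI insertI1 subsetD)
  \<comment> \<open>For \<open>u \<noteq> 0\<close> this solves \<open>\<phi> u = \<langle>u, g + c u\<rangle>\<close>, as \<open>u\<close> is orthogonal to \<open>g\<close>.\<close>
  define c where "c = cnj (\<phi> u / ip u u)"
  define g' where "g' = g + cscale c u"
  have u_val: "\<phi> u = ip u g'"
  proof (cases "u = 0")
    case True
    then have "\<phi> u = 0"
      using insert.prems(1)[of 0 0] by simp
    then show ?thesis
      using True by (simp add: ip_zero_left)
  next
    case False
    then have "ip u u \<noteq> 0"
      using ip_self_eq_zero by blast
    then show ?thesis
      by (simp add: g'_def c_def ip_add_right ip_scale_right orth' g(1))
  qed
  have "g' \<in> span (insert e E)"
    unfolding g'_def by (meson g(1) u_span span_add span_scale span_mono subset_insertI subsetD)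
  moreover have "\<phi> h = ip h g'" if h_span: "h \<in> span (insert e E)" for h
  proof -
    obtain k where k: "h - cscale k e \<in> span E"
      using h_span span_breakdown_eq by blast
    define w where "w = (h - cscale k e) + cscale k p"
    have w: "w \<in> span E"
      unfolding w_def by (intro span_add span_scale k p(1))
    have h: "h = cscale k u + w"
      by (simp add: w_def e scale_right_distrib)
    have "\<phi> w = ip w g'"
      using w by (simp add: g(2) g'_def ip_add_right ip_scale_right orth)
    then show ?thesis
      by (simp add: h insert.prems ip_add_left ip_scale_left u_val)
  qed
  ultimately show ?case
    by blast
qed

text \<open>
  The upper frame bound makes both factors square integrable, and \<open>|a b| \<le> |a|\<^sup>2 + |b|\<^sup>2\<close>.
\<close>

lemma integrable_frame_product:
  assumes F: "continuous_frame ip M F"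
  shows "integrable M (\<lambda>s. ip f (F s) * ip (F s) g)"
proof -
  have meas: "(\<lambda>s. ip x (F s)) \<in> borel_measurable M" for x
    using F by (simp add: continuous_frame_def weakly_measurable_def)
  have sq: "integrable M (\<lambda>s. (cmod (ip x (F s)))\<^sup>2)" for x
  proof (rule integrableI_nonneg)
    obtain B :: real where "(\<integral>\<^sup>+s. ennreal ((cmod (ip x (F s)))\<^sup>2) \<partial>M) \<le> ennreal (B * (ip_norm ip x)\<^sup>2)"
      using F unfolding continuous_frame_def by blast
    then show "(\<integral>\<^sup>+s. ennreal ((cmod (ip x (F s)))\<^sup>2) \<partial>M) < \<infinity>"
      using ennreal_less_top le_less_trans by (metis infinity_ennreal_def)
  qed (use meas in auto)
  have conj: "ip (F s) g = cnj (ip g (F s))" for s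
    by (rule ip_commute)
  show ?thesis
  proof (rule Bochner_Integration.integrable_bound)
    show "integrable M (\<lambda>s. (cmod (ip f (F s)))\<^sup>2 + (cmod (ip g (F s)))\<^sup>2)"
      using sq by simp
    have "(\<lambda>s. cnj (ip g (F s))) \<in> borel_measurable M"
      by (rule measurable_compose[OF meas borel_measurable_continuous_onI]) (intro continuous_intros)
    then show "(\<lambda>s. ip f (F s) * ip (F s) g) \<in> borel_measurable M"
      unfolding conj using meas by measurable
    have "a * b \<le> a\<^sup>2 + b\<^sup>2" if "0 \<le> a" "0 \<le> b" for a b :: real
      using sum_squares_bound[of a b] mult_nonneg_nonneg[OF that] by linarith
    then show "AE s in M. norm (ip f (F s) * ip (F s) g)
        \<le> norm ((cmod (ip f (F s)))\<^sup>2 + (cmod (ip g (F s)))\<^sup>2)"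
      by (simp add: conj norm_mult)
  qed
qed

end

context complex_hilbert_space_of_dim
begin

lemma riesz_representation:
  assumes "\<And>x y. \<phi> (x + y) = \<phi> x + \<phi> y"
    and "\<And>c x. \<phi> (cscale c x) = c * \<phi> x"
  obtains g where "\<And>h. \<phi> h = ip h g"
proof -
  obtain E where "finite E" "span E = UNIV"
    using ex_basis by blast
  then show ?thesis
    using riesz_representation_span[of E \<phi>] assms that by auto
qed

lemma adjoint_vector_exists:
  assumes V: "Vector_Spaces.linear cscale cscale V"
  obtains g' where "\<And>h. ip (V h) g = ip h g'"
proof -
  have "ip (V (x + y)) g = ip (V x) g + ip (V y) g"
    and "ip (V (cscale c x)) g = c * ip (V x) g" for x y c
    using V by (simp_all add: Vector_Spaces.linear_iff ip_add_left ip_scale_left)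
  then show ?thesis
    using riesz_representation[of "\<lambda>h. ip (V h) g"] that by blast
qed

text \<open>
  The characteristic property of the frame operator. As \<open>\<integral> \<langle>f, F s\<rangle> \<langle>F s, g\<rangle> d\<mu>(s)\<close> is antilinear in
  \<open>g\<close>, it is its complex conjugate that the Riesz theorem represents.
\<close>

lemma has_integral_frame_operator:
  assumes F: "continuous_frame ip M F"
  shows "has_bochner_integral M (\<lambda>s. ip f (F s) * ip (F s) g) (ip (frame_operator ip M F f) g)"
proof -
  define \<phi> where "\<phi> g = (\<integral>s. ip g (F s) * ip (F s) f \<partial>M)" for g
  note int = integrable_frame_product[OF F]
  have add: "\<phi> (x + y) = \<phi> x + \<phi> y" for x y
    unfolding \<phi>_def using int by (simp add: ip_add_left distrib_right)
  have scale: "\<phi> (cscale c x) = c * \<phi> x" for c x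
    unfolding \<phi>_def by (simp add: ip_scale_left mult.assoc)
  obtain h where h: "\<And>g. \<phi> g = ip g h"
    using riesz_representation[of \<phi>] add scale by blast
  have weak: "\<forall>g. has_bochner_integral M (\<lambda>s. ip f (F s) * ip (F s) g) (ip h g)"
  proof
    fix g
    have "ip f (F s) * ip (F s) g = cnj (ip g (F s) * ip (F s) f)" for s
      using ip_commute[of f "F s"] ip_commute[of "F s" g] by simp
    then have "(\<integral>s. ip f (F s) * ip (F s) g \<partial>M) = cnj (\<phi> g)"
      unfolding \<phi>_def by (simp only: Bochner_Integration.integral_cnj)
    also have "\<dots> = ip h g"
      by (simp add: h ip_commute[of h g])
    finally show "has_bochner_integral M (\<lambda>s. ip f (F s) * ip (F s) g) (ip h g)"
      using int by (simp add: has_bochner_integral_iff)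
  qed
  have "\<forall>g. has_bochner_integral M (\<lambda>s. ip f (F s) * ip (F s) g)
      (ip (frame_operator ip M F f) g)"
    unfolding frame_operator_def
  proof (rule theI[where a = h], rule weak)
    fix h' assume weak': "\<forall>g. has_bochner_integral M (\<lambda>s. ip f (F s) * ip (F s) g) (ip h' g)"
    show "h' = h"
      by (rule ip_ext, rule has_bochner_integral_eq[OF weak'[rule_format] weak[rule_format]])
  qed
  then show ?thesis
    by blast
qed

lemma linear_frame_operator:
  assumes F: "continuous_frame ip M F"
  shows "Vector_Spaces.linear cscale cscale (frame_operator ip M F)"
proof -
  note S = has_integral_frame_operator[OF F]
  show ?thesis
    unfolding Vector_Spaces.linear_iff
  proof (intro conjI allI)
    fix x y
    show "frame_operator ip M F (x + y) = frame_operator ip M F x + frame_operator ip M F y"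
    proof (rule ip_ext, rule has_bochner_integral_eq[OF S])
      fix g
      show "has_bochner_integral M (\<lambda>s. ip (x + y) (F s) * ip (F s) g)
          (ip (frame_operator ip M F x + frame_operator ip M F y) g)"
        using has_bochner_integral_add[OF S[of x g] S[of y g]]
        by (simp add: ip_add_left distrib_right)
    qed
  next
    fix c x
    show "frame_operator ip M F (cscale c x) = cscale c (frame_operator ip M F x)"
    proof (rule ip_ext, rule has_bochner_integral_eq[OF S])
      fix g
      show "has_bochner_integral M (\<lambda>s. ip (cscale c x) (F s) * ip (F s) g)
          (ip (cscale c (frame_operator ip M F x)) g)"
        using has_bochner_integral_mult_right[of c, OF S[of x g]]
        by (simp add: ip_scale_left mult.assoc)
    qed
  qed unfold_locales
qed

text \<open>
  The lower frame bound says that \<open>A \<parallel>f\<parallel>\<^sup>2 \<le> \<langle>S f, f\<rangle>\<close>, so the kernel of \<open>S\<close> is trivial; in finite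
  dimension an injective linear operator is surjective.
\<close>

lemma bij_frame_operator:
  assumes F: "continuous_frame ip M F"
  shows "bij (frame_operator ip M F)"
proof -
  obtain E where E: "finite E" "independent E" "span E = UNIV"
    using ex_basis by blast
  interpret fd: finite_dimensional_vector_space cscale E
    by unfold_locales (use E in auto)
  let ?S = "frame_operator ip M F"
  have lin: "Vector_Spaces.linear cscale cscale ?S"
    by (rule linear_frame_operator[OF F])
  have "f = 0" if "?S f = 0" for f
  proof (rule ccontr)
    assume "f \<noteq> 0"
    obtain A :: real where A: "0 < A"
      "ennreal (A * (ip_norm ip f)\<^sup>2) \<le> (\<integral>\<^sup>+s. ennreal ((cmod (ip f (F s)))\<^sup>2) \<partial>M)"
      using F unfolding continuous_frame_def by blast
    have "has_bochner_integral M (\<lambda>s. ip f (F s) * ip (F s) f) 0"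
      using has_integral_frame_operator[OF F, of f f] that by (simp add: ip_zero_left)
    moreover have "ip f (F s) * ip (F s) f = complex_of_real ((cmod (ip f (F s)))\<^sup>2)" for s
      using complex_norm_square[of "ip f (F s)"] by (simp add: ip_commute[of "F s" f])
    ultimately have "has_bochner_integral M (\<lambda>s. complex_of_real ((cmod (ip f (F s)))\<^sup>2)) 0"
      by simp
    from has_bochner_integral_Re[OF this]
    have "has_bochner_integral M (\<lambda>s. (cmod (ip f (F s)))\<^sup>2) 0"
      by simp
    then have "(\<integral>\<^sup>+s. ennreal ((cmod (ip f (F s)))\<^sup>2) \<partial>M) = 0"
      using nn_integral_eq_integral[of M "\<lambda>s. (cmod (ip f (F s)))\<^sup>2"]
      by (simp add: has_bochner_integral_iff)
    with A(2) have "A * (ip_norm ip f)\<^sup>2 \<le> 0"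
      by (simp add: ennreal_eq_0_iff)
    moreover have "0 < (ip_norm ip f)\<^sup>2"
      using ip_pos_def[OF \<open>f \<noteq> 0\<close>] by (simp add: ip_norm_def)
    ultimately show False
      using A(1) by (simp add: mult_le_0_iff)
  qed
  then have "inj ?S"
    using module_hom.inj_iff_eq_0[OF module_hom_linearI[OF lin]] by blast
  then show ?thesis
    using fd.linear_inj_imp_surj[OF lin] by (simp add: bij_def)
qed

lemma control_operator_comp_frame_operator:
  assumes F: "continuous_frame ip M F"
    and tight: "tight_controlled_frame cscale ip M F \<alpha> V"
  shows "V (frame_operator ip M F f) = cscale \<alpha> f"
proof -
  let ?S = "frame_operator ip M F"
  have V: "Vector_Spaces.linear cscale cscale V"
    using tight by (simp add: tight_controlled_frame_def invertible_operator_def)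
  have S: "Vector_Spaces.linear cscale cscale ?S"
    by (rule linear_frame_operator[OF F])
  have quad: "ip (V (?S x)) x = \<alpha> * ip x x" for x
  proof -
    obtain x' where x': "\<And>h. ip (V h) x = ip h x'"
      using adjoint_vector_exists[OF V] by blast
    have "has_bochner_integral M (\<lambda>s. ip x (F s) * ip (V (F s)) x) (ip (V (?S x)) x)"
      unfolding x' by (rule has_integral_frame_operator[OF F])
    moreover have "has_bochner_integral M (\<lambda>s. ip x (F s) * ip (V (F s)) x) (\<alpha> * ip x x)"
      using tight by (simp add: tight_controlled_frame_def ip_norm_square[symmetric])
    ultimately show ?thesis
      by (rule has_bochner_integral_eq)
  qed
  have "V (?S f) - cscale \<alpha> f = 0"
  proof (rule zero_quadratic_form_imp_zero[of "\<lambda>x. V (?S x) - cscale \<alpha> x"])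
    show "Vector_Spaces.linear cscale cscale (\<lambda>x. V (?S x) - cscale \<alpha> x)"
      using V S by (simp add: Vector_Spaces.linear_iff scale_right_distrib scale_right_diff_distrib
          mult.commute)
    show "ip (V (?S x) - cscale \<alpha> x) x = 0" for x
      by (simp add: ip_diff_left ip_scale_left quad)
  qed
  then show ?thesis
    by simp
qed

end

theorem theorem2p20:
  fixes cscale :: "complex \<Rightarrow> 'h \<Rightarrow> 'h::ab_group_add"
    and ip :: "'h \<Rightarrow> 'h \<Rightarrow> complex"
    and N :: nat
    and M :: "'s measure"
    and F :: "'s \<Rightarrow> 'h"
    and V :: "'h \<Rightarrow> 'h"
    and \<alpha> :: complex
  assumes "complex_hilbert_space_of_dim cscale ip N"
    and "continuous_frame ip M F"
    and "invertible_operator cscale V"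
    and "tight_controlled_frame cscale ip M F \<alpha> V"
  shows "V = (\<lambda>f. cscale \<alpha> (inv (frame_operator ip M F) f)) \<and>
    tight_controlled_frame cscale ip M F \<alpha> (\<lambda>f. cscale \<alpha> (inv (frame_operator ip M F) f))"
proof -
  interpret complex_hilbert_space_of_dim cscale ip N
    by (rule assms(1))
  have "surj (frame_operator ip M F)"
    using bij_frame_operator[OF assms(2)] by (rule bij_is_surj)
  then have "V f = cscale \<alpha> (inv (frame_operator ip M F) f)" for f
    using control_operator_comp_frame_operator[OF assms(2,4), of "inv (frame_operator ip M F) f"]
    by (simp add: surj_f_inv_f)
  then have "V = (\<lambda>f. cscale \<alpha> (inv (frame_operator ip M F) f))"
    by (rule ext)
  with assms(4) show ?thesis
    by simp
qed

end
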